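(* Let $\ell$ be a positive multiple of $4$ and let $A$ be a long tree. Then there exist subsets $\alpha_+,\alpha_-\subset A$ such that for any diameter $D$ of $A$, the endpoints of $D$ can be labelled $u_+,u_-$ so that $\alpha_+$ is the complement in $A$ of the $\frac{\ell}{4}$-neighborhood of $u_-$, and $\alpha_-$ is the complement in $A$ of the $\frac{\ell}{4}$-neighborhood of $u_+$.
   Context: Trees are finite and are regarded as metric trees with all edges of length $1$; $|A|$ denotes the number of edges of $A$ and $\operatorname{diam}A$ its diameter. A tree $A$ with $\frac{\ell}{4}\le|A|\le\frac{\ell}{2}$ is called long if $\frac12\left(|A|+\frac{\ell}{4}\right)<\operatorname{diam}A$. A diameter of $A$ is a path in $A$ of length $\operatorname{diam}A$. The $r$-neighborhood of a point $u$ is the set of points at distance less than $r$ from $u$. *)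

theory Defs
  imports "HOL-Analysis.Analysis"
begin

definition is_tree :: "'a set \<Rightarrow> 'a set set \<Rightarrow> bool" where
  "is_tree V E \<longleftrightarrow>
     finite V \<and> V \<noteq> {} \<and> (\<forall>e\<in>E. e \<subseteq> V \<and> card e = 2) \<and>
     (\<forall>u\<in>V. \<forall>v\<in>V. \<exists>p. p \<noteq> [] \<and> hd p = u \<and> last p = v \<and> successively (\<lambda>a b. {a, b} \<in> E) p) \<and>
     \<not> (\<exists>p. 3 \<le> length p \<and> distinct p \<and> successively (\<lambda>a b. {a, b} \<in> E) p \<and> {last p, hd p} \<in> E)"

text \<open>
  Points of the metric tree are given by barycentric coordinates: the vertex \<open>v\<close> is the indicator
  function of \<open>v\<close>, and the point of the edge \<open>{u, v}\<close> at distance \<open>t\<close> from \<open>u\<close> takes the value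
  \<open>1 - t\<close> at \<open>u\<close>, \<open>t\<close> at \<open>v\<close> and \<open>0\<close> elsewhere.
\<close>

definition cell :: "'a set \<Rightarrow> ('a \<Rightarrow> real) set" where
  "cell e = {x. (\<forall>v. 0 \<le> x v) \<and> (\<forall>v. v \<notin> e \<longrightarrow> x v = 0) \<and> sum x e = 1}"

definition points :: "'a set \<Rightarrow> 'a set set \<Rightarrow> ('a \<Rightarrow> real) set" where
  "points V E = (\<Union>v\<in>V. cell {v}) \<union> (\<Union>e\<in>E. cell e)"

definition polygon_length :: "('b \<Rightarrow> 'b \<Rightarrow> real) \<Rightarrow> 'b list \<Rightarrow> real" where
  "polygon_length d xs = (\<Sum>i<length xs - 1. d (xs ! i) (xs ! Suc i))"

text \<open>
  For two points of one closed edge \<open>{u, v}\<close> the coordinates at \<open>u\<close> and \<open>v\<close> differ by the same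
  absolute value, namely the distance within the edge of length \<open>1\<close>; hence the factor \<open>1/2\<close>.
\<close>

definition segment_length :: "'a set \<Rightarrow> ('a \<Rightarrow> real) \<Rightarrow> ('a \<Rightarrow> real) \<Rightarrow> real" where
  "segment_length V x y = (\<Sum>v\<in>V. \<bar>x v - y v\<bar>) / 2"

definition edge_chains :: "'a set \<Rightarrow> 'a set set \<Rightarrow> ('a \<Rightarrow> real) \<Rightarrow> ('a \<Rightarrow> real) \<Rightarrow> ('a \<Rightarrow> real) list set" where
  "edge_chains V E x y =
     {xs. xs \<noteq> [] \<and> hd xs = x \<and> last xs = y \<and>
          successively (\<lambda>p q. \<exists>e\<in>E. p \<in> cell e \<and> q \<in> cell e) xs}"

text \<open>
  The length metric: infimum of the lengths of point sequences whose consecutive points share a closed edge.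
  The value \<open>0\<close> outside the set of points only serves to meet the totality conventions of
  \<^locale>\<open>Metric_space\<close>.
\<close>

definition tree_dist :: "'a set \<Rightarrow> 'a set set \<Rightarrow> ('a \<Rightarrow> real) \<Rightarrow> ('a \<Rightarrow> real) \<Rightarrow> real" where
  "tree_dist V E x y =
     (if x \<in> points V E \<and> y \<in> points V E
      then INF xs\<in>edge_chains V E x y. polygon_length (segment_length V) xs
      else 0)"

definition tree_ball :: "'a set \<Rightarrow> 'a set set \<Rightarrow> ('a \<Rightarrow> real) \<Rightarrow> real \<Rightarrow> ('a \<Rightarrow> real) set" where
  "tree_ball V E = Metric_space.mball (points V E) (tree_dist V E)"

definition tree_diam :: "'a set \<Rightarrow> 'a set set \<Rightarrow> real" where
  "tree_diam V E = (SUP (x, y)\<in>points V E \<times> points V E. tree_dist V E x y)"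

definition is_long :: "nat \<Rightarrow> 'a set \<Rightarrow> 'a set set \<Rightarrow> bool" where
  "is_long l V E \<longleftrightarrow>
     is_tree V E \<and> real l / 4 \<le> real (card E) \<and> real (card E) \<le> real l / 2 \<and>
     1 / 2 * (real (card E) + real l / 4) < tree_diam V E"

text \<open>
  A path is an embedded (injective) arc \<open>[0, 1] \<rightarrow> A\<close>, and its length is the supremum of the
  lengths of inscribed polygons.  A diameter is given by a parametrization \<open>D\<close>, so that its
  endpoints are \<open>D 0\<close> and \<open>D 1\<close>; these are arbitrary points, not required to be vertices.
\<close>

definition tree_path :: "'a set \<Rightarrow> 'a set set \<Rightarrow> (real \<Rightarrow> 'a \<Rightarrow> real) \<Rightarrow> bool" where
  "tree_path V E g \<longleftrightarrow>
     pathin (Metric_space.mtopology (points V E) (tree_dist V E)) g \<and> inj_on g {0..1}"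

definition path_length :: "'a set \<Rightarrow> 'a set set \<Rightarrow> (real \<Rightarrow> 'a \<Rightarrow> real) \<Rightarrow> ereal" where
  "path_length V E g =
     (SUP ts\<in>{ts. sorted ts \<and> set ts \<subseteq> {0..1}}. ereal (polygon_length (tree_dist V E) (map g ts)))"

definition is_diameter :: "'a set \<Rightarrow> 'a set set \<Rightarrow> (real \<Rightarrow> 'a \<Rightarrow> real) \<Rightarrow> bool" where
  "is_diameter V E D \<longleftrightarrow> tree_path V E D \<and> path_length V E D = ereal (tree_diam V E)"

lemma polygon_length_Cons2 [simp]:
  "polygon_length d (x # y # zs) = d x y + polygon_length d (y # zs)"
  unfolding polygon_length_def by (simp add: sum.lessThan_Suc_shift del: sum.lessThan_Suc)

lemma polygon_length_short [simp]: "polygon_length d [] = 0" "polygon_length d [x] = 0"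
  by (simp_all add: polygon_length_def)

lemma polygon_length_join:
  "polygon_length d (xs @ z # ys) = polygon_length d (xs @ [z]) + polygon_length d (z # ys)"
proof (induction xs)
  case (Cons a xs)
  then show ?case by (cases xs) auto
qed simp

lemma polygon_length_rev:
  assumes "\<And>x y. d x y = d y x"
  shows "polygon_length d (rev xs) = polygon_length d xs"
proof (induction xs)
  case (Cons a xs)
  show ?case
  proof (cases xs)
    case Nil
    then show ?thesis by simp
  next
    case (Cons b ys)
    then show ?thesis
      using Cons.IH polygon_length_join[of d "rev ys" b "[a]"] assms[of a b] by simp
  qed
qed simp

lemma segment_length_ge_0: "0 \<le> segment_length V x y"
  by (simp add: segment_length_def sum_nonneg)

lemma segment_length_commute: "segment_length V x y = segment_length V y x"
  by (simp add: segment_length_def abs_minus_commute)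

lemma segment_length_triangle: "segment_length V x z \<le> segment_length V x y + segment_length V y z"
proof -
  have "(\<Sum>v\<in>V. \<bar>x v - z v\<bar>) \<le> (\<Sum>v\<in>V. \<bar>x v - y v\<bar> + \<bar>y v - z v\<bar>)"
    by (rule sum_mono) linarith
  then show ?thesis by (simp add: segment_length_def sum.distrib)
qed

lemma polygon_length_ge_0: "0 \<le> polygon_length (segment_length V) xs"
  by (simp add: polygon_length_def sum_nonneg segment_length_ge_0)

lemma segment_le_polygon:
  "xs \<noteq> [] \<Longrightarrow> segment_length V (hd xs) (last xs) \<le> polygon_length (segment_length V) xs"
proof (induction xs rule: induct_list012)
  case (2 x)
  then show ?case by (simp add: segment_length_def)
next
  case (3 x y zs)
  then show ?case
    using segment_length_triangle[of V x "last (y # zs)" y] by fastforce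
qed simp

lemma edge_chains_rev: "xs \<in> edge_chains V E x y \<Longrightarrow> rev xs \<in> edge_chains V E y x"
  by (auto simp: edge_chains_def hd_rev last_rev conj_commute)

lemma edge_chains_join:
  assumes "xs \<in> edge_chains V E x y" "ys \<in> edge_chains V E y z"
  obtains zs where "zs \<in> edge_chains V E x z"
    "polygon_length (segment_length V) zs =
     polygon_length (segment_length V) xs + polygon_length (segment_length V) ys"
proof -
  obtain xs' where xs: "xs = xs' @ [y]"
    using assms(1) by (cases xs rule: rev_cases) (auto simp: edge_chains_def)
  obtain ys' where ys: "ys = y # ys'"
    using assms(2) by (cases ys) (auto simp: edge_chains_def)
  show ?thesis
  proof
    show "xs' @ y # ys' \<in> edge_chains V E x z"
      using assms unfolding xs ys edge_chains_def
      by (auto simp: successively_append_iff hd_append split: if_splits)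
    show "polygon_length (segment_length V) (xs' @ y # ys') =
      polygon_length (segment_length V) xs + polygon_length (segment_length V) ys"
      unfolding xs ys by (rule polygon_length_join)
  qed
qed

lemma indicator_in_cell: "finite e \<Longrightarrow> v \<in> e \<Longrightarrow> (\<lambda>w. if w = v then 1 else 0) \<in> cell e"
  by (auto simp: cell_def)

lemma cell_singleton: "x \<in> cell {v} \<Longrightarrow> x = (\<lambda>w. if w = v then 1 else 0)"
  by (auto simp: cell_def)

lemma chain_to_vertex:
  assumes "is_tree V E" "x \<in> points V E"
  obtains v xs where "v \<in> V" "xs \<in> edge_chains V E x (\<lambda>w. if w = v then 1 else 0)"
proof -
  consider v where "v \<in> V" "x \<in> cell {v}" | e where "e \<in> E" "x \<in> cell e"
    using assms(2) by (auto simp: points_def)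
  then show ?thesis
  proof cases
    case 1
    then have "[x] \<in> edge_chains V E x (\<lambda>w. if w = v then 1 else 0)"
      using cell_singleton by (auto simp: edge_chains_def)
    then show ?thesis using that 1 by blast
  next
    case 2
    then have e: "e \<subseteq> V" "finite e" "e \<noteq> {}"
      using assms(1) by (auto simp: is_tree_def dest: finite_subset)
    then obtain v where v: "v \<in> e" by blast
    then have "[x, \<lambda>w. if w = v then 1 else 0] \<in> edge_chains V E x (\<lambda>w. if w = v then 1 else 0)"
      using 2 indicator_in_cell[OF e(2) v] by (auto simp: edge_chains_def)
    then show ?thesis using that e v by blast
  qed
qed

lemma chain_vertices:
  assumes "is_tree V E" "u \<in> V" "v \<in> V"
  shows "edge_chains V E (\<lambda>w. if w = u then 1 else 0) (\<lambda>w. if w = v then 1 else 0) \<noteq> {}"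
proof -
  let ?i = "\<lambda>v w. if w = v then 1 else (0::real)"
  obtain p where p: "p \<noteq> []" "hd p = u" "last p = v" "successively (\<lambda>a b. {a, b} \<in> E) p"
    using assms unfolding is_tree_def by blast
  have "successively (\<lambda>p q. \<exists>e\<in>E. p \<in> cell e \<and> q \<in> cell e) (map ?i p)"
    unfolding successively_map
  proof (rule successively_mono[OF p(4)])
    fix a b assume "{a, b} \<in> E"
    moreover have "?i a \<in> cell {a, b}" "?i b \<in> cell {a, b}"
      by (rule indicator_in_cell; simp)+
    ultimately show "\<exists>e\<in>E. ?i a \<in> cell e \<and> ?i b \<in> cell e" by blast
  qed
  then have "map ?i p \<in> edge_chains V E (?i u) (?i v)"
    using p by (simp add: edge_chains_def hd_map last_map)
  then show ?thesis by blast
qed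

lemma edge_chains_nonempty:
  assumes "is_tree V E" "x \<in> points V E" "y \<in> points V E"
  shows "edge_chains V E x y \<noteq> {}"
proof -
  obtain u xs where u: "u \<in> V" "xs \<in> edge_chains V E x (\<lambda>w. if w = u then 1 else 0)"
    using chain_to_vertex[OF assms(1,2)] .
  obtain v ys where v: "v \<in> V" "ys \<in> edge_chains V E y (\<lambda>w. if w = v then 1 else 0)"
    using chain_to_vertex[OF assms(1,3)] .
  obtain ps where "ps \<in> edge_chains V E (\<lambda>w. if w = u then 1 else 0) (\<lambda>w. if w = v then 1 else 0)"
    using chain_vertices[OF assms(1) u(1) v(1)] by blast
  then obtain qs where "qs \<in> edge_chains V E x (\<lambda>w. if w = v then 1 else 0)"
    using edge_chains_join[OF u(2)] by blast
  then show ?thesis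
    using edge_chains_join[OF _ edge_chains_rev[OF v(2)]] by blast
qed

lemma chain_bdd: "bdd_below (polygon_length (segment_length V) ` S)"
  by (rule bdd_belowI2[of _ 0]) (rule polygon_length_ge_0)

lemma Metric_space_tree:
  assumes tree: "is_tree V E"
  shows "Metric_space (points V E) (tree_dist V E)"
proof
  fix x y
  show "0 \<le> tree_dist V E x y"
    using edge_chains_nonempty[OF tree]
    by (auto simp: tree_dist_def intro!: cINF_greatest polygon_length_ge_0)
  have "polygon_length (segment_length V) ` edge_chains V E a b
    \<subseteq> polygon_length (segment_length V) ` edge_chains V E b a" for a b
  proof (rule image_subsetI)
    fix xs assume "xs \<in> edge_chains V E a b"
    then show "polygon_length (segment_length V) xs \<in> polygon_length (segment_length V) ` edge_chains V E b a"
      using polygon_length_rev[of "segment_length V" xs, OF segment_length_commute]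
      by (intro image_eqI[OF _ edge_chains_rev]) auto
  qed
  then have "polygon_length (segment_length V) ` edge_chains V E x y
    = polygon_length (segment_length V) ` edge_chains V E y x"
    by (intro subset_antisym)
  then show "tree_dist V E x y = tree_dist V E y x"
    by (simp add: tree_dist_def)
next
  fix x y assume xy: "x \<in> points V E" "y \<in> points V E"
  show "tree_dist V E x y = 0 \<longleftrightarrow> x = y"
  proof
    assume "tree_dist V E x y = 0"
    moreover have "segment_length V x y \<le> tree_dist V E x y"
    proof -
      have "segment_length V x y \<le> polygon_length (segment_length V) xs" if "xs \<in> edge_chains V E x y" for xs
        using segment_le_polygon[of xs V] that by (auto simp: edge_chains_def)
      then show ?thesis
        using xy edge_chains_nonempty[OF tree xy] by (auto simp: tree_dist_def intro!: cINF_greatest)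
    qed
    ultimately have "(\<Sum>v\<in>V. \<bar>x v - y v\<bar>) = 0"
      by (intro antisym sum_nonneg) (simp_all add: segment_length_def)
    then have "\<forall>v\<in>V. x v = y v"
      using tree by (simp add: is_tree_def sum_nonneg_eq_0_iff)
    moreover have off: "\<forall>v. v \<notin> V \<longrightarrow> z v = 0" if "z \<in> points V E" for z
    proof -
      have "\<exists>e\<subseteq>V. z \<in> cell e"
        using that tree by (fastforce simp: points_def is_tree_def)
      then show ?thesis by (auto simp: cell_def)
    qed
    ultimately have "x v = y v" for v
      using off[OF xy(1)] off[OF xy(2)] by (cases "v \<in> V") simp_all
    then show "x = y" by (rule ext)
  next
    assume "x = y"
    then have "[x] \<in> edge_chains V E x y" by (simp add: edge_chains_def)
    then have "tree_dist V E x y \<le> 0"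
      using cINF_lower[OF chain_bdd, of "[x]"] xy by (simp add: tree_dist_def)
    moreover have "0 \<le> tree_dist V E x y"
      using edge_chains_nonempty[OF tree]
      by (auto simp: tree_dist_def intro!: cINF_greatest polygon_length_ge_0)
    ultimately show "tree_dist V E x y = 0" by simp
  qed
next
  fix x y z assume xyz: "x \<in> points V E" "y \<in> points V E" "z \<in> points V E"
  let ?L = "polygon_length (segment_length V)"
  have le: "tree_dist V E x z \<le> ?L xs + ?L ys"
    if xs: "xs \<in> edge_chains V E x y" and ys: "ys \<in> edge_chains V E y z" for xs ys
  proof -
    obtain zs where zs: "zs \<in> edge_chains V E x z" "?L zs = ?L xs + ?L ys"
      using edge_chains_join[OF xs ys] by blast
    have "tree_dist V E x z \<le> ?L zs"
      using cINF_lower[OF chain_bdd zs(1)] xyz by (simp add: tree_dist_def)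
    then show ?thesis using zs(2) by simp
  qed
  have "tree_dist V E x z - ?L xs \<le> tree_dist V E y z" if "xs \<in> edge_chains V E x y" for xs
  proof -
    have "tree_dist V E x z - ?L xs \<le> (INF ys\<in>edge_chains V E y z. ?L ys)"
      using edge_chains_nonempty[OF tree xyz(2,3)] le[OF that]
      by (intro cINF_greatest) (auto simp: algebra_simps)
    then show ?thesis using xyz by (simp add: tree_dist_def)
  qed
  then have "tree_dist V E x z - tree_dist V E y z \<le> (INF xs\<in>edge_chains V E x y. ?L xs)"
    using edge_chains_nonempty[OF tree xyz(1,2)]
    by (intro cINF_greatest) (auto simp: algebra_simps)
  then show "tree_dist V E x z \<le> tree_dist V E x y + tree_dist V E y z"
    using xyz by (simp add: tree_dist_def)
qed

end

theory Submission
  imports Defs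
begin

text \<open>
  Write \<open>d = diam A\<close> and \<open>r = l / 4\<close>. The metric of a tree satisfies the four-point condition, and the
  perimeter of a triangle is at most \<open>2|A|\<close>, since each edge contributes at most \<open>2\<close> to it.
  For two diameters, the four-point condition allows one to label the endpoints so that
  \<open>d(u\<^sub>+, v\<^sub>-) = d(u\<^sub>-, v\<^sub>+) = d\<close>. The triangle \<open>u\<^sub>-, u\<^sub>+, v\<^sub>-\<close> then yields
  \<open>d(u\<^sub>-, v\<^sub>-) \<le> 2|A| - 2d < |A| - r \<le> r\<close>. The four-point condition for \<open>x, u\<^sub>-, v\<^sub>-, u\<^sub>+\<close> gives
  \<open>d(x, v\<^sub>-) \<le> max (d(x, u\<^sub>-)) (d(u\<^sub>-, v\<^sub>-))\<close>, so the \<open>r\<close>-neighborhoods of \<open>u\<^sub>-\<close> and \<open>v\<^sub>-\<close> coincide.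
  That the endpoints of a diameter are at distance \<open>d\<close> holds because an injective path in a space
  with the four-point condition is a geodesic.
\<close>

section \<open>Injective paths under the four-point condition\<close>

text \<open>Gromov's 0-hyperbolicity: for a metric, the two largest of the three sums obtained by
  pairing off four points are equal.\<close>

definition four_point :: "'b set \<Rightarrow> ('b \<Rightarrow> 'b \<Rightarrow> real) \<Rightarrow> bool" where
  "four_point M d \<longleftrightarrow>
     (\<forall>x\<in>M. \<forall>y\<in>M. \<forall>z\<in>M. \<forall>w\<in>M. d x y + d z w \<le> max (d x z + d y w) (d x w + d y z))"

lemma four_pointD:
  "\<lbrakk>four_point M d; x \<in> M; y \<in> M; z \<in> M; w \<in> M\<rbrakk>
    \<Longrightarrow> d x y + d z w \<le> max (d x z + d y w) (d x w + d y z)"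
  by (simp add: four_point_def)

context Metric_space
begin

text \<open>If \<open>S\<close> contained no such point, the open sets \<open>near\<close> and
  \<open>far\<close> would separate \<open>b\<close> from \<open>a\<close> within
  \<open>S\<close>.\<close>

lemma connectedin_contains_between:
  assumes fp: "four_point M d" and S: "connectedin mtopology S" "a \<in> S" "b \<in> S"
    and k: "0 \<le> k" "k \<le> d a b"
  obtains p where "p \<in> S" "d b p = k" "d a p + d p b = d a b"
proof -
  have SM: "S \<subseteq> M"
    using connectedin_subset_topspace[OF S(1)] by simp
  then have ab: "a \<in> M" "b \<in> M" using S by auto
  have "\<exists>p\<in>S. d b p = k \<and> d a p + d p b = d a b"
  proof (cases "k = 0")
    case True
    then show ?thesis using S ab by (intro bexI[of _ b]) auto
  next
    case False
    show ?thesis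
    proof (rule ccontr)
      assume none: "\<not> ?thesis"
      \<comment> \<open>The quantity \<open>d b y + d a b - d a y\<close> is twice the Gromov
        product of \<open>a\<close> and \<open>y\<close> at \<open>b\<close>, and that product is at
        most \<open>d b y\<close>. A point with product at least \<open>k\<close> and
        \<open>d b y = k\<close> would thus be the point sought, so \<open>near\<close> and
        \<open>far\<close> still cover \<open>S\<close>.\<close>
      define near where "near = {y \<in> M. d b y + d a b - d a y < 2 * k}"
      define far where "far = {y \<in> M. 2 * k \<le> d b y + d a b - d a y \<and> d b y \<noteq> k}"
      have "openin mtopology near"
        unfolding openin_mtopology
      proof (intro conjI ballI allI impI)
        fix y assume y: "y \<in> near"
        let ?r = "(2 * k - (d b y + d a b - d a y)) / 2"
        have "mball y ?r \<subseteq> near"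
        proof
          fix z assume "z \<in> mball y ?r"
          then have z: "z \<in> M" "d y z < ?r" by auto
          then show "z \<in> near"
            using y ab triangle[of b y z] triangle[of a z y] commute[of y z] by (simp add: near_def)
        qed
        moreover have "?r > 0" using y by (simp add: near_def)
        ultimately show "\<exists>r>0. mball y r \<subseteq> near" by blast
      qed (auto simp: near_def)
      moreover have "openin mtopology far"
        unfolding openin_mtopology
      proof (intro conjI ballI allI impI)
        fix y assume y: "y \<in> far"
        then have yM: "y \<in> M" by (simp add: far_def)
        let ?r = "d b y - k"
        have "mball y ?r \<subseteq> far"
        proof
          fix z assume "z \<in> mball y ?r"
          then have z: "z \<in> M" "d y z < ?r" by auto
          \<comment> \<open>In the first alternative the Gromov product does not drop from
            \<open>y\<close> to \<open>z\<close>. In the second, \<open>d a b - d a z\<close>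
            exceeds \<open>k\<close>, and \<open>d b z\<close> exceeds \<open>k\<close> in any
            case.\<close>
          have "d a z + d y b \<le> max (d a y + d z b) (d a b + d z y)"
            by (rule four_pointD[OF fp]) (use ab yM z in auto)
          then show "z \<in> far"
            using y z yM ab triangle[of b z y] commute[of y z] commute[of y b] commute[of z b]
            by (auto simp: far_def)
        qed
        \<comment> \<open>The Gromov product is at most \<open>d b y\<close>, so \<open>k\<close>
          \<le> \<open>d b y\<close>, and equality is excluded in \<open>far\<close>.\<close>
        moreover have "?r > 0"
          using y triangle[of a y b] triangle[of a b y] triangle[of b a y] ab commute[of y b]
            commute[of a b] by (simp add: far_def)
        ultimately show "\<exists>r>0. mball y r \<subseteq> far" by blast
      qed (auto simp: far_def)
      moreover have "S \<subseteq> near \<union> far"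
      proof
        fix y assume y: "y \<in> S"
        then have yM: "y \<in> M" using SM by blast
        have "\<not> (d b y = k \<and> d a y + d y b = d a b)" using none y by blast
        then show "y \<in> near \<union> far"
          using yM ab triangle[of a y b] commute[of y b] by (auto simp: near_def far_def)
      qed
      moreover have "near \<inter> far \<inter> S = {}" by (auto simp: near_def far_def)
      moreover have "b \<in> near \<inter> S" using ab S k False by (auto simp: near_def)
      moreover have "a \<in> far \<inter> S"
      proof -
        have "d b a \<noteq> k"
          using none S ab by (auto simp: commute)
        then show ?thesis using ab S k commute[of a b] by (simp add: far_def)
      qed
      ultimately show False
        using S(1) unfolding connectedin by blast
    qed
  qed
  then show ?thesis using that by blast
qed

text \<open>An injective path cannot backtrack. Both arcs issuing from \<open>g s\<close> contain a
  point at distance \<open>k\<close> on the way to their far ends; the four-point condition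
  identifies these two points, and injectivity then forces them to be \<open>g s\<close>, so
  \<open>k = 0\<close>.\<close>

lemma injective_path_additive:
  assumes fp: "four_point M d" and g: "pathin mtopology g" "inj_on g {0..1}"
    and t: "0 \<le> r" "r \<le> s" "s \<le> t" "t \<le> 1"
  shows "d (g r) (g t) = d (g r) (g s) + d (g s) (g t)"
proof -
  have conn: "connectedin mtopology (g ` {u..v})" if "0 \<le> u" "v \<le> 1" for u v
  proof (rule connectedin_continuous_map_image)
    show "continuous_map (top_of_set {0..1}) mtopology g"
      using g(1) by (simp add: pathin_def)
    show "connectedin (top_of_set {0..1}) {u..v}"
      using that by (auto simp: connectedin_subtopology)
  qed
  have gM: "g u \<in> M" if "0 \<le> u" "u \<le> 1" for u
    using connectedin_subset_topspace[OF conn[of u u]] that by simp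
  define a b c where abc: "a = g r" "b = g s" "c = g t"
  have M: "a \<in> M" "b \<in> M" "c \<in> M" using gM t by (auto simp: abc)
  \<comment> \<open>The Gromov product of the outer points as seen from the middle one: the distance
    at which both arcs issuing from \<open>b\<close> would still coincide.\<close>
  define k where "k = (d a b + d c b - d a c) / 2"
  have k: "0 \<le> k" "k \<le> d a b" "k \<le> d c b"
    using M triangle[of a b c] triangle[of a c b] triangle[of c a b] commute[of a c] commute[of c b]
    by (auto simp: k_def)
  obtain p where p: "p \<in> g ` {r..s}" "d b p = k" "d a p + d p b = d a b"
    using connectedin_contains_between[OF fp conn, of r s a b k] t k by (auto simp: abc)
  obtain q where q: "q \<in> g ` {s..t}" "d b q = k" "d c q + d q b = d c b"
    using connectedin_contains_between[OF fp conn, of s t c b k] t k by (auto simp: abc)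
  have pq: "p \<in> M" "q \<in> M" using p q gM t by auto
  \<comment> \<open>The second inequality yields \<open>d q a\<close> \<le>
    \<open>d a b - k\<close>; with it, both alternatives of the first are at most
    \<open>d a b\<close>.\<close>
  have "d p q + d a b \<le> max (d p a + d q b) (d p b + d q a)"
    by (rule four_pointD[OF fp]) (use M pq in auto)
  moreover have "d q a + d b c \<le> max (d q b + d a c) (d q c + d a b)"
    by (rule four_pointD[OF fp]) (use M pq in auto)
  ultimately have "d p q \<le> 0"
    using p q commute[of b p] commute[of b q] commute[of a p] commute[of c q] commute[of b c]
    by (auto simp: k_def max_def split: if_splits)
  then have "p = q" using pq by (metis nonneg zero order_antisym)
  \<comment> \<open>The parameter intervals of the two arcs meet only in \<open>s\<close>.\<close>
  then have "p = b"
    using p(1) q(1) g(2) t unfolding abc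
    by (smt (verit) atLeastAtMost_iff image_iff inj_on_def)
  then have "k = 0" using p M by simp
  then show ?thesis using commute[of b c] by (simp add: k_def abc)
qed

text \<open>The sides telescope by additivity. Taking the supremum, an injective path is no longer
  than the distance of its endpoints.\<close>

lemma polygon_length_injective_path_le:
  assumes fp: "four_point M d" and g: "pathin mtopology g" "inj_on g {0..1}"
    and ts: "sorted ts" "set ts \<subseteq> {0..1}"
  shows "polygon_length d (map g ts) \<le> d (g 0) (g 1)"
proof (cases ts)
  case Nil
  then show ?thesis by simp
next
  case (Cons t ts')
  have "polygon_length d (map g (t # ts')) \<le> d (g t) (g 1)"
    using ts unfolding Cons
  proof (induction ts' arbitrary: t)
    case (Cons u us)
    then show ?case
      using injective_path_additive[OF fp g, of t u 1] by auto
  qed simp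
  also have "\<dots> \<le> d (g 0) (g 1)"
    using injective_path_additive[OF fp g, of 0 t 1] ts Cons by simp
  finally show ?thesis using Cons by simp
qed

end

section \<open>Trees as iterated leaf attachments\<close>

text \<open>Supplies an induction over trees, which the description by connectedness and absence of
  cycles does not offer directly.\<close>

inductive grown :: "'a set \<Rightarrow> 'a set set \<Rightarrow> bool" where
  root: "grown {r} {}"
| leaf: "grown V E \<Longrightarrow> v \<in> V \<Longrightarrow> w \<notin> V \<Longrightarrow> grown (insert w V) (insert {v, w} E)"

lemma grown_finite: "grown V E \<Longrightarrow> finite V \<and> finite E \<and> (\<forall>e\<in>E. e \<subseteq> V)"
  by (induction rule: grown.induct) auto

lemma grown_path:
  assumes "grown V E" "a \<in> V" "b \<in> V"
  shows "\<exists>p. p \<noteq> [] \<and> distinct p \<and> set p \<subseteq> V \<and> hd p = a \<and> last p = b \<and>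
    successively (\<lambda>x y. {x, y} \<in> E) p"
  using assms
proof (induction arbitrary: a b rule: grown.induct)
  case (root r)
  then show ?case by (intro exI[of _ "[r]"]) auto
next
  case (leaf V E v w)
  let ?E = "insert {v, w} E"
  have mono: "successively (\<lambda>x y. {x, y} \<in> ?E) p"
    if "successively (\<lambda>x y. {x, y} \<in> E) p" for p
    using that by (rule successively_mono) auto
  consider "a = w" "b = w" | "a = w" "b \<in> V" | "a \<in> V" "b = w" | "a \<in> V" "b \<in> V"
    using leaf.prems by auto
  then show ?case
  proof cases
    case 1
    then show ?thesis by (intro exI[of _ "[w]"]) auto
  next
    case 2
    then obtain p where "p \<noteq> []" "distinct p" "set p \<subseteq> V" "hd p = v" "last p = b"
      "successively (\<lambda>x y. {x, y} \<in> E) p"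
      using leaf.IH leaf.hyps by blast
    then show ?thesis
      using 2 leaf.hyps mono
      by (intro exI[of _ "w # p"]) (auto simp: successively_Cons insert_commute)
  next
    case 3
    then obtain p where "p \<noteq> []" "distinct p" "set p \<subseteq> V" "hd p = a" "last p = v"
      "successively (\<lambda>x y. {x, y} \<in> E) p"
      using leaf.IH leaf.hyps by blast
    then show ?thesis
      using 3 leaf.hyps mono
      by (intro exI[of _ "p @ [w]"]) (auto simp: successively_append_iff)
  next
    case 4
    then obtain p where "p \<noteq> []" "distinct p" "set p \<subseteq> V" "hd p = a" "last p = b"
      "successively (\<lambda>x y. {x, y} \<in> E) p"
      using leaf.IH by blast
    then show ?thesis using mono by (intro exI[of _ p]) auto
  qed
qed

lemma successively_crossing:
  assumes "successively R p" "p \<noteq> []" "hd p \<in> A" "last p \<notin> A"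
  shows "\<exists>x y. x \<in> A \<and> y \<notin> A \<and> R x y"
  using assms
proof (induction p rule: induct_list012)
  case (3 x y zs)
  then show ?case by (cases "y \<in> A") auto
qed auto

text \<open>Take a grown subgraph with the most vertices. A missing vertex would give an edge
  leaving it, along which it could be enlarged; a missing edge would close a cycle with a simple
  path of the subgraph.\<close>

lemma is_tree_grown:
  assumes tree: "is_tree V E"
  shows "grown V E"
proof -
  have fin: "finite V" "V \<noteq> {}" and edge: "\<And>e. e \<in> E \<Longrightarrow> e \<subseteq> V \<and> card e = 2"
    and acyclic: "\<And>p. \<lbrakk>3 \<le> length p; distinct p; successively (\<lambda>a b. {a, b} \<in> E) p\<rbrakk>
      \<Longrightarrow> {last p, hd p} \<notin> E"
    using tree unfolding is_tree_def by blast+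
  define sub where
    "sub n \<longleftrightarrow> (\<exists>V' E'. grown V' E' \<and> V' \<subseteq> V \<and> E' \<subseteq> E \<and> card V' = n)" for n
  obtain r where "r \<in> V" using fin by blast
  then have "sub 1"
    unfolding sub_def by (intro exI[of _ "{r}"] exI[of _ "{}"]) (auto intro: grown.root)
  have le: "n \<le> card V" if "sub n" for n
    using fin that by (auto simp: sub_def intro: card_mono)
  define m where "m = Greatest sub"
  have "sub m"
    unfolding m_def using \<open>sub 1\<close> le by (rule GreatestI_nat)
  then obtain V' E' where V': "grown V' E'" "V' \<subseteq> V" "E' \<subseteq> E" "card V' = m"
    by (auto simp: sub_def)
  have ne: "V' \<noteq> {}" using V'(1) by cases auto
  have "V' = V"
  proof (rule ccontr)
    assume "V' \<noteq> V"
    then obtain a b where ab: "a \<in> V'" "b \<in> V" "b \<notin> V'" using V'(2) ne by blast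
    then obtain p where "p \<noteq> []" "hd p = a" "last p = b" "successively (\<lambda>a b. {a, b} \<in> E) p"
      using tree V'(2) unfolding is_tree_def by blast
    then obtain x y where xy: "x \<in> V'" "y \<notin> V'" "{x, y} \<in> E"
      using successively_crossing[of "\<lambda>a b. {a, b} \<in> E" p V'] ab by blast
    have "sub (Suc m)"
      unfolding sub_def
    proof (rule exI[of _ "insert y V'"], rule exI[of _ "insert {x, y} E'"], intro conjI)
      show "grown (insert y V') (insert {x, y} E')"
        using V'(1) xy(1,2) by (rule grown.leaf)
      show "insert y V' \<subseteq> V" "insert {x, y} E' \<subseteq> E" using edge xy V' by auto
      show "card (insert y V') = Suc m"
        using V'(4) xy(2) grown_finite[OF V'(1)] by simp
    qed
    then have "Suc m \<le> m" unfolding m_def by (rule Greatest_le_nat) (rule le)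
    then show False by simp
  qed
  moreover have "E \<subseteq> E'"
  proof
    fix e assume e: "e \<in> E"
    then obtain a b where ab: "e = {a, b}" "a \<noteq> b" "a \<in> V'" "b \<in> V'"
      using edge[OF e] \<open>V' = V\<close> by (auto simp: card_2_iff)
    obtain p where p: "p \<noteq> []" "distinct p" "hd p = a" "last p = b"
      "successively (\<lambda>x y. {x, y} \<in> E') p"
      using grown_path[OF V'(1) ab(3,4)] by blast
    show "e \<in> E'"
    proof (rule ccontr)
      assume "e \<notin> E'"
      \<comment> \<open>A path with one vertex would give \<open>a = b\<close>, and one with two
        vertices would put \<open>e\<close> into \<open>E'\<close>.\<close>
      with p ab have "3 \<le> length p"
        by (cases p rule: remdups_adj.cases) (auto simp: Suc_le_eq split: if_splits)
      moreover have "successively (\<lambda>x y. {x, y} \<in> E) p"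
        using p(5) by (rule successively_mono) (use V' in auto)
      ultimately have "{last p, hd p} \<notin> E" using acyclic p(2) by blast
      then show False using p ab e by (simp add: insert_commute)
    qed
  qed
  ultimately have "V' = V" "E' = E" using V'(3) by auto
  then show ?thesis using V'(1) by simp
qed

section \<open>The length metric, built leaf by leaf\<close>

text \<open>
  The last two clauses force \<open>\<rho>\<close> to be \<open>tree_dist V E\<close>. Keeping \<open>\<rho>\<close> abstract lets one build it by adding
  leaves, without showing that the intermediate subgraphs are trees.
\<close>

definition tree_like_metric ::
    "'a set \<Rightarrow> 'a set set \<Rightarrow> (('a \<Rightarrow> real) \<Rightarrow> ('a \<Rightarrow> real) \<Rightarrow> real) \<Rightarrow> bool" where
  "tree_like_metric V E \<rho> \<longleftrightarrow>
     (\<forall>x\<in>points V E. \<rho> x x = 0) \<and>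
     (\<forall>x\<in>points V E. \<forall>y\<in>points V E. \<rho> x y = \<rho> y x) \<and>
     (\<forall>x\<in>points V E. \<forall>y\<in>points V E. \<forall>z\<in>points V E. \<rho> x z \<le> \<rho> x y + \<rho> y z) \<and>
     four_point (points V E) \<rho> \<and>
     (\<forall>x\<in>points V E. \<forall>y\<in>points V E. \<forall>z\<in>points V E.
        \<rho> x y + \<rho> y z + \<rho> x z \<le> 2 * real (card E)) \<and>
     (\<forall>e\<in>E. \<forall>x\<in>cell e. \<forall>y\<in>cell e. \<rho> x y \<le> segment_length V x y) \<and>
     (\<forall>x\<in>points V E. \<forall>y\<in>points V E.
        \<exists>xs\<in>edge_chains V E x y. polygon_length (segment_length V) xs \<le> \<rho> x y)"

lemma points_support:
  assumes "\<And>e. e \<in> E \<Longrightarrow> e \<subseteq> V" "x \<in> points V E" "w \<notin> V"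
  shows "x w = 0"
proof -
  have "\<exists>e\<subseteq>V. x \<in> cell e"
    using assms(1,2) unfolding points_def by blast
  then show ?thesis using assms(3) by (auto simp: cell_def)
qed

lemma chain_points:
  assumes "successively (\<lambda>p q. \<exists>e\<in>E. p \<in> cell e \<and> q \<in> cell e) xs" "xs \<noteq> []"
    "hd xs \<in> points V E"
  shows "set xs \<subseteq> points V E"
  using assms
proof (induction xs rule: induct_list012)
  case (3 x y zs)
  then have "y \<in> points V E" by (auto simp: points_def)
  then show ?case using 3 by simp
qed auto

lemma cell_pair:
  assumes "v \<noteq> w" "x \<in> cell {v, w}"
  shows "x v = 1 - x w" "0 \<le> x w" "x w \<le> 1" "\<And>u. u \<noteq> v \<Longrightarrow> u \<noteq> w \<Longrightarrow> x u = 0"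
proof -
  have x: "x v + x w = 1" "\<And>u. 0 \<le> x u" "\<And>u. u \<noteq> v \<Longrightarrow> u \<noteq> w \<Longrightarrow> x u = 0"
    using assms by (auto simp: cell_def)
  show "x v = 1 - x w" "0 \<le> x w" "x w \<le> 1" "\<And>u. u \<noteq> v \<Longrightarrow> u \<noteq> w \<Longrightarrow> x u = 0"
    using x x(2)[of v] x(2)[of w] by (simp_all, linarith)
qed

lemma segment_length_cell_pair:
  assumes "finite V" "v \<in> V" "w \<in> V" "v \<noteq> w" "x \<in> cell {v, w}" "y \<in> cell {v, w}"
  shows "segment_length V x y = \<bar>x w - y w\<bar>"
proof -
  have "(\<Sum>u\<in>V. \<bar>x u - y u\<bar>) = (\<Sum>u\<in>{v, w}. \<bar>x u - y u\<bar>)"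
    by (rule sum.mono_neutral_right) (use assms in \<open>auto simp: cell_pair(4)[OF assms(4)]\<close>)
  then show ?thesis
    using assms cell_pair(1)[OF assms(4,5)] cell_pair(1)[OF assms(4,6)]
    by (simp add: segment_length_def)
qed

text \<open>The new edge is glued on at \<open>v\<close>: the coordinate \<open>x w\<close> is the
  height of \<open>x\<close> above the old tree, and \<open>\<pi>\<close> collapses the new edge to
  its foot \<open>\<delta>\<close>. Distances are height differences plus old distances of the
  projections.\<close>

lemma tree_like_metric_leaf:
  assumes g: "grown V E" and v: "v \<in> V" and w: "w \<notin> V" and \<rho>: "tree_like_metric V E \<rho>"
  shows "\<exists>\<rho>'. tree_like_metric (insert w V) (insert {v, w} E) \<rho>'"
proof -
  let ?V = "insert w V" and ?E = "insert {v, w} E"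
  let ?P = "points V E" and ?P' = "points ?V ?E"
  note r = \<rho>[unfolded tree_like_metric_def]
  have fin: "finite V" "finite E" and sub: "\<And>e. e \<in> E \<Longrightarrow> e \<subseteq> V"
    using grown_finite[OF g] by auto
  have vw: "v \<noteq> w" using v w by auto
  define \<delta> :: "'a \<Rightarrow> real" where "\<delta> = (\<lambda>u. if u = v then 1 else 0)"
  define \<pi> where "\<pi> x = (if x w = 0 then x else \<delta>)" for x :: "'a \<Rightarrow> real"
  define \<rho>' where "\<rho>' x y = \<bar>x w - y w\<bar> + \<rho> (\<pi> x) (\<pi> y)" for x y
  have \<delta>P: "\<delta> \<in> ?P"
    using v indicator_in_cell[of "{v}" v] by (auto simp: points_def \<delta>_def)
  have \<delta>c: "\<delta> \<in> cell {v, w}" unfolding \<delta>_def by (rule indicator_in_cell) auto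
  have \<delta>w: "\<delta> w = 0" using vw by (simp add: \<delta>_def)
  have old: "x w = 0" if "x \<in> ?P" for x
    using points_support[OF sub that w] .
  have new: "\<pi> x = \<delta>" if "x \<in> cell {v, w}" for x
    using cell_pair[OF vw that] by (force simp: \<pi>_def \<delta>_def)
  have split: "x \<in> ?P \<and> x w = 0 \<and> \<pi> x = x \<or> x \<in> cell {v, w} \<and> 0 \<le> x w \<and> x w \<le> 1 \<and> \<pi> x = \<delta>"
    if "x \<in> ?P'" for x
  proof -
    have "x \<in> ?P \<or> x \<in> cell {w} \<or> x \<in> cell {v, w}" using that by (auto simp: points_def)
    then consider "x \<in> ?P" | "x \<in> cell {w}" | "x \<in> cell {v, w}" by (elim disjE)
    then show ?thesis
    proof cases
      case 1
      then show ?thesis using old by (simp add: \<pi>_def)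
    next
      case 2
      then have "x \<in> cell {v, w}" using cell_singleton[of x w] indicator_in_cell[of "{v, w}" w] by simp
      then show ?thesis using cell_pair[OF vw] new by blast
    next
      case 3
      then show ?thesis using cell_pair[OF vw] new by blast
    qed
  qed
  have pos: "0 \<le> x w" "x w \<le> 1" "x w = 0 \<or> \<pi> x = \<delta>" "\<pi> x \<in> ?P" if "x \<in> ?P'" for x
    using split[OF that] \<delta>P by auto
  have seg: "segment_length ?V x y = segment_length V x y" if "x w = 0" "y w = 0" for x y
    using that fin w by (simp add: segment_length_def)
  have poly: "polygon_length (segment_length ?V) xs = polygon_length (segment_length V) xs"
    if "\<forall>x\<in>set xs. x w = 0" for xs
    using that by (induction xs rule: induct_list012) (auto simp: seg)
  have tri: "\<rho> x z \<le> \<rho> x y + \<rho> y z" if "x \<in> ?P" "y \<in> ?P" "z \<in> ?P" for x y z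
    using r that by blast
  have sym: "\<rho> x y = \<rho> y x" if "x \<in> ?P" "y \<in> ?P" for x y
    using r that by blast
  have zer: "\<rho> x x = 0" if "x \<in> ?P" for x
    using r that by blast
  have nn: "0 \<le> \<rho> x y" if "x \<in> ?P" "y \<in> ?P" for x y
    using tri[OF that(1,2,1)] sym[OF that] zer[OF that(1)] by simp
  have per: "\<rho> x y + \<rho> y z + \<rho> x z \<le> 2 * real (card E)"
    if "x \<in> ?P" "y \<in> ?P" "z \<in> ?P" for x y z
    using r that by blast
  have fp: "four_point ?P \<rho>" using r by blast
  have fp': "four_point ?P' \<rho>'"
    unfolding four_point_def
  proof (intro ballI)
    fix a b c e assume P': "a \<in> ?P'" "b \<in> ?P'" "c \<in> ?P'" "e \<in> ?P'"
    note P = P'[THEN pos(4)]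
    have "\<rho> (\<pi> a) (\<pi> b) + \<rho> (\<pi> c) (\<pi> e)
      \<le> max (\<rho> (\<pi> a) (\<pi> c) + \<rho> (\<pi> b) (\<pi> e)) (\<rho> (\<pi> a) (\<pi> e) + \<rho> (\<pi> b) (\<pi> c))"
      by (rule four_pointD[OF fp P])
    \<comment> \<open>Each of the four points has height 0 or projects to \<open>\<delta>\<close>;
      every combination follows from the old inequality and triangle inequalities.\<close>
    then show "\<rho>' a b + \<rho>' c e \<le> max (\<rho>' a c + \<rho>' b e) (\<rho>' a e + \<rho>' b c)"
      unfolding \<rho>'_def
      using P'[THEN pos(1)] P'[THEN pos(3)] P[THEN zer] zer[OF \<delta>P]
        tri[OF P(1,3,2)] tri[OF P(1,4,2)] tri[OF P(3,1,4)] tri[OF P(3,2,4)]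
        sym[OF P(1,2)] sym[OF P(1,3)] sym[OF P(1,4)] sym[OF P(2,3)] sym[OF P(2,4)] sym[OF P(3,4)]
      by (elim disjE; simp; smt (verit))
  qed
  have per': "\<rho>' x y + \<rho>' y z + \<rho>' x z \<le> 2 * real (card ?E)"
    if "x \<in> ?P'" "y \<in> ?P'" "z \<in> ?P'" for x y z
  proof -
    \<comment> \<open>The edge count grows by one. The three height differences between numbers in
      [0, 1] add up to at most 2, which is what the new edge may contribute to a perimeter.\<close>
    have "{v, w} \<notin> E" using sub w by blast
    then have "card ?E = Suc (card E)" using fin by simp
    then show ?thesis
      using per[OF that[THEN pos(4)]] that[THEN pos(1)] that[THEN pos(2)]
      unfolding \<rho>'_def by simp
  qed
  have seg': "\<rho>' x y \<le> segment_length ?V x y"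
    if e: "e \<in> ?E" and xy: "x \<in> cell e" "y \<in> cell e" for e x y
  proof (cases "e \<in> E")
    case True
    then have "x \<in> ?P" "y \<in> ?P" using xy by (auto simp: points_def)
    then have "x w = 0" "y w = 0" by (auto intro: old)
    moreover from this have "\<rho>' x y = \<rho> x y" by (simp add: \<rho>'_def \<pi>_def)
    ultimately show ?thesis using r True xy seg by metis
  next
    case False
    then have "x \<in> cell {v, w}" "y \<in> cell {v, w}" using e xy by auto
    then show ?thesis
      using segment_length_cell_pair[of ?V v w x y] fin v vw new zer[OF \<delta>P] by (simp add: \<rho>'_def)
  qed
  have chain': "\<exists>xs\<in>edge_chains ?V ?E x y. polygon_length (segment_length ?V) xs \<le> \<rho>' x y"
    if xy: "x \<in> ?P'" "y \<in> ?P'" for x y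
  \<comment> \<open>Two points of the new edge are joined directly, since a detour through the foot
    could be too long. Otherwise the chain descends to \<open>\<pi> x\<close>, crosses the old tree
    and climbs from \<open>\<pi> y\<close>.\<close>
  proof (cases "x \<in> cell {v, w} \<and> y \<in> cell {v, w}")
    case True
    then have "[x, y] \<in> edge_chains ?V ?E x y" by (auto simp: edge_chains_def)
    moreover have "polygon_length (segment_length ?V) [x, y] \<le> \<rho>' x y"
      using True segment_length_cell_pair[of ?V v w x y] fin v vw new zer[OF \<delta>P]
      by (simp add: \<rho>'_def)
    ultimately show ?thesis by blast
  next
    case False
    obtain xs where xs: "xs \<in> edge_chains V E (\<pi> x) (\<pi> y)"
      "polygon_length (segment_length V) xs \<le> \<rho> (\<pi> x) (\<pi> y)"
      using r pos(4)[OF xy(1)] pos(4)[OF xy(2)] by blast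
    have suc: "successively (\<lambda>p q. \<exists>e\<in>E. p \<in> cell e \<and> q \<in> cell e) xs"
      and ends: "xs \<noteq> []" "hd xs = \<pi> x" "last xs = \<pi> y"
      using xs(1) by (auto simp: edge_chains_def)
    have "set xs \<subseteq> ?P"
      using chain_points[OF suc] ends pos(4)[OF xy(1)] by simp
    then have "polygon_length (segment_length ?V) xs = polygon_length (segment_length V) xs"
      using old by (intro poly) blast
    moreover have "xs \<in> edge_chains ?V ?E (\<pi> x) (\<pi> y)"
      using ends successively_mono[OF suc, of "\<lambda>p q. \<exists>e\<in>?E. p \<in> cell e \<and> q \<in> cell e"]
      by (simp add: edge_chains_def)
    moreover have leg: "\<exists>zs\<in>edge_chains ?V ?E z (\<pi> z).
      polygon_length (segment_length ?V) zs \<le> z w" if "z \<in> ?P'" for z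
    proof (cases "\<pi> z = z")
      case True
      then show ?thesis
        using pos(1)[OF that] by (intro bexI[of _ "[z]"]) (auto simp: edge_chains_def)
    next
      case False
      then have z: "z \<in> cell {v, w}" "\<pi> z = \<delta>" using split[OF that] by auto
      then have "segment_length ?V z \<delta> = z w"
        using segment_length_cell_pair[of ?V v w z \<delta>] fin v vw \<delta>c \<delta>w pos(1)[OF that] by simp
      then show ?thesis
        using z \<delta>c by (intro bexI[of _ "[z, \<delta>]"]) (auto simp: edge_chains_def)
    qed
    obtain p where "p \<in> edge_chains ?V ?E x (\<pi> x)"
      "polygon_length (segment_length ?V) p \<le> x w" using leg[OF xy(1)] by blast
    moreover obtain q where "q \<in> edge_chains ?V ?E y (\<pi> y)"
      "polygon_length (segment_length ?V) q \<le> y w" using leg[OF xy(2)] by blast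
    moreover have "polygon_length (segment_length ?V) (rev q)
      = polygon_length (segment_length ?V) q"
      by (rule polygon_length_rev) (rule segment_length_commute)
    ultimately obtain zs where "zs \<in> edge_chains ?V ?E x y"
      "polygon_length (segment_length ?V) zs \<le> x w + \<rho> (\<pi> x) (\<pi> y) + y w"
      using xs(2) edge_chains_rev edge_chains_join by (smt (verit))
    \<comment> \<open>One of the two points lies in the old tree and has height 0, so the height
      difference equals the sum of the heights.\<close>
    moreover have "x w + \<rho> (\<pi> x) (\<pi> y) + y w = \<rho>' x y"
      using False split[OF xy(1)] split[OF xy(2)] by (auto simp: \<rho>'_def)
    ultimately show ?thesis by auto
  qed
  have tri': "\<rho>' x z \<le> \<rho>' x y + \<rho>' y z" if "x \<in> ?P'" "y \<in> ?P'" "z \<in> ?P'" for x y z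
    using tri[OF that[THEN pos(4)]] by (simp add: \<rho>'_def)
  have sym': "\<rho>' x y = \<rho>' y x" if "x \<in> ?P'" "y \<in> ?P'" for x y
    using sym[OF that[THEN pos(4)]] by (simp add: \<rho>'_def)
  have zer': "\<rho>' x x = 0" if "x \<in> ?P'" for x
    using zer[OF pos(4)[OF that]] by (simp add: \<rho>'_def)
  have "tree_like_metric ?V ?E \<rho>'"
    unfolding tree_like_metric_def
    by (intro conjI ballI; (rule fp' zer' sym' tri' per' seg' chain'; assumption?))
  then show ?thesis by blast
qed

lemma grown_tree_like_metric: "grown V E \<Longrightarrow> \<exists>\<rho>. tree_like_metric V E \<rho>"
proof (induction rule: grown.induct)
  case (root r)
  have eq: "x = y" if "x \<in> points {r} {}" "y \<in> points {r} {}" for x y :: "'a \<Rightarrow> real"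
    using cell_singleton[of x r] cell_singleton[of y r] that by (simp add: points_def)
  have "\<exists>xs\<in>edge_chains {r} {} x y. polygon_length (segment_length {r}) xs \<le> 0"
    if "x \<in> points {r} {}" "y \<in> points {r} {}" for x y
    using eq[OF that] by (intro bexI[of _ "[x]"]) (auto simp: edge_chains_def)
  then have "tree_like_metric {r} {} (\<lambda>x y. 0)"
    unfolding tree_like_metric_def four_point_def by simp
  then show ?case by blast
next
  case (leaf V E v w)
  from leaf.IH obtain \<rho> where "tree_like_metric V E \<rho>" ..
  with leaf.hyps show ?case by (rule tree_like_metric_leaf)
qed

text \<open>Gives the lower bound for the infimum that defines \<open>tree_dist\<close>.\<close>

lemma tree_like_metric_le_polygon:
  assumes \<rho>: "tree_like_metric V E \<rho>"
    and xs: "xs \<noteq> []" "hd xs \<in> points V E"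
      "successively (\<lambda>p q. \<exists>e\<in>E. p \<in> cell e \<and> q \<in> cell e) xs"
  shows "\<rho> (hd xs) (last xs) \<le> polygon_length (segment_length V) xs"
  using xs
proof (induction xs rule: induct_list012)
  case (2 x)
  then show ?case using \<rho> by (simp add: tree_like_metric_def)
next
  case (3 x y zs)
  then obtain e where e: "e \<in> E" "x \<in> cell e" "y \<in> cell e" by auto
  have yP: "y \<in> points V E" using e by (auto simp: points_def)
  have suc: "successively (\<lambda>p q. \<exists>e\<in>E. p \<in> cell e \<and> q \<in> cell e) (y # zs)" using "3.prems" by simp
  have "last (y # zs) \<in> points V E"
    using chain_points[OF suc, of V] yP last_in_set[of "y # zs"] by auto
  then have "\<rho> x (last (y # zs)) \<le> \<rho> x y + \<rho> y (last (y # zs))"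
    using \<rho> yP "3.prems"(2) unfolding tree_like_metric_def by simp
  moreover have "\<rho> x y \<le> segment_length V x y"
    using \<rho> e unfolding tree_like_metric_def by blast
  moreover have "\<rho> y (last (y # zs)) \<le> polygon_length (segment_length V) (y # zs)"
    using "3.IH"(2) yP suc by simp
  ultimately show ?case by simp
qed simp

lemma tree_like_metric_eq_tree_dist:
  assumes \<rho>: "tree_like_metric V E \<rho>" and xy: "x \<in> points V E" "y \<in> points V E"
  shows "\<rho> x y = tree_dist V E x y"
proof (rule antisym)
  obtain xs where xs: "xs \<in> edge_chains V E x y" "polygon_length (segment_length V) xs \<le> \<rho> x y"
    using \<rho> xy unfolding tree_like_metric_def by blast
  have "tree_dist V E x y \<le> polygon_length (segment_length V) xs"
    using xy cINF_lower[OF chain_bdd xs(1)] by (simp add: tree_dist_def)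
  then show "tree_dist V E x y \<le> \<rho> x y" using xs by simp
  have "\<rho> x y \<le> polygon_length (segment_length V) ys" if "ys \<in> edge_chains V E x y" for ys
    using tree_like_metric_le_polygon[OF \<rho>, of ys] that xy by (auto simp: edge_chains_def)
  then show "\<rho> x y \<le> tree_dist V E x y"
    using xs xy by (auto simp: tree_dist_def intro!: cINF_greatest)
qed

text \<open>Both properties are carried along the leaf construction by \<open>\<rho>\<close>, which
  agrees with \<open>tree_dist\<close> on all points.\<close>

lemma
  assumes "is_tree V E"
  shows four_point_tree_dist: "four_point (points V E) (tree_dist V E)"
    and tree_dist_perimeter: "\<And>x y z. \<lbrakk>x \<in> points V E; y \<in> points V E; z \<in> points V E\<rbrakk>
      \<Longrightarrow> tree_dist V E x y + tree_dist V E y z + tree_dist V E x z \<le> 2 * real (card E)"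
proof -
  obtain \<rho> where \<rho>: "tree_like_metric V E \<rho>"
    using grown_tree_like_metric[OF is_tree_grown[OF assms]] by blast
  have "four_point (points V E) \<rho>" using \<rho> by (simp add: tree_like_metric_def)
  then show "four_point (points V E) (tree_dist V E)"
    unfolding four_point_def by (simp add: tree_like_metric_eq_tree_dist[OF \<rho>])
  show "tree_dist V E x y + tree_dist V E y z + tree_dist V E x z \<le> 2 * real (card E)"
    if "x \<in> points V E" "y \<in> points V E" "z \<in> points V E" for x y z
    using \<rho> that tree_like_metric_eq_tree_dist[OF \<rho>] unfolding tree_like_metric_def by metis
qed

section \<open>Diameters of long trees\<close>

text \<open>The supremum \<open>tree_diam\<close> is over a bounded set: the perimeter bound applies
  to the degenerate triangle \<open>p\<close>, \<open>q\<close>, \<open>q\<close>.\<close>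

lemma tree_dist_le_diam:
  assumes tree: "is_tree V E" and "x \<in> points V E" "y \<in> points V E"
  shows "tree_dist V E x y \<le> tree_diam V E"
proof -
  interpret Metric_space "points V E" "tree_dist V E" by (rule Metric_space_tree[OF tree])
  have "tree_dist V E p q \<le> 2 * real (card E)" if "p \<in> points V E" "q \<in> points V E" for p q
    using tree_dist_perimeter[OF tree that that(2)] nonneg[of p q] nonneg[of q q] by linarith
  then have "bdd_above ((\<lambda>(x, y). tree_dist V E x y) ` (points V E \<times> points V E))"
    by (intro bdd_aboveI2[of _ _ "2 * real (card E)"]) auto
  then show ?thesis
    using cSUP_upper[of "(x, y)" "points V E \<times> points V E" "\<lambda>(x, y). tree_dist V E x y"] assms
    by (simp add: tree_diam_def)
qed

text \<open>The length of \<open>D\<close> is at most the distance of its endpoints, which is at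
  most the diameter; since the length equals the diameter, so does the distance.\<close>

lemma diameter_endpoints:
  assumes tree: "is_tree V E" and D: "is_diameter V E D"
  shows "D 0 \<in> points V E" "D 1 \<in> points V E" "tree_dist V E (D 0) (D 1) = tree_diam V E"
proof -
  interpret Metric_space "points V E" "tree_dist V E" by (rule Metric_space_tree[OF tree])
  have path: "pathin mtopology D" "inj_on D {0..1}"
    and len: "path_length V E D = ereal (tree_diam V E)"
    using D by (auto simp: is_diameter_def tree_path_def)
  have "D ` {0..1} \<subseteq> points V E"
    using path_image_subset_topspace[OF path(1)] by auto
  then show P: "D 0 \<in> points V E" "D 1 \<in> points V E" by auto
  have "path_length V E D \<le> ereal (tree_dist V E (D 0) (D 1))"
    unfolding path_length_def
    using polygon_length_injective_path_le[OF four_point_tree_dist[OF tree] path]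
    by (auto intro!: SUP_least)
  then show "tree_dist V E (D 0) (D 1) = tree_diam V E"
    using len tree_dist_le_diam[OF tree P] by simp
qed

lemma long_tree_ball_eq:
  assumes long: "is_long l V E"
    and P: "u \<in> points V E" "v \<in> points V E" "u' \<in> points V E" "v' \<in> points V E"
    and diam: "tree_dist V E u v = tree_diam V E" "tree_dist V E u' v = tree_diam V E"
  shows "tree_ball V E u (real l / 4) = tree_ball V E u' (real l / 4)"
proof -
  have tree: "is_tree V E" using long by (simp add: is_long_def)
  interpret Metric_space "points V E" "tree_dist V E" by (rule Metric_space_tree[OF tree])
  let ?d = "tree_dist V E"
  \<comment> \<open>All assumptions on sizes enter here:
    \<open>2 * card E - 2 * tree_diam V E < card E - l / 4\<close> by longness, and the right side
    is at most \<open>l / 4\<close>.\<close>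
  have close: "?d u u' < real l / 4"
    using tree_dist_perimeter[OF tree P(1,2,3)] diam long commute[of v u']
    by (simp add: is_long_def field_simps)
  have sub: "tree_ball V E a (real l / 4) \<subseteq> tree_ball V E b (real l / 4)"
    if ab: "a \<in> points V E" "b \<in> points V E" "?d a v = tree_diam V E" "?d b v = tree_diam V E"
      "?d a b < real l / 4" for a b
  proof
    fix x assume "x \<in> tree_ball V E a (real l / 4)"
    then have x: "x \<in> points V E" "?d a x < real l / 4" by (auto simp: tree_ball_def)
    \<comment> \<open>As \<open>d x v\<close> is at most the common value of \<open>d a v\<close>
      and \<open>d b v\<close>, the alternatives give \<open>d b x\<close> \<le>
      \<open>d b a\<close> and \<open>d b x\<close> \<le> \<open>d x a\<close>; both bounds are
      below \<open>l / 4\<close>.\<close>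
    have "?d b x + ?d a v \<le> max (?d b a + ?d x v) (?d b v + ?d x a)"
      by (rule four_pointD[OF four_point_tree_dist[OF tree]]) (use ab x P in auto)
    moreover have "?d x v \<le> tree_diam V E" using tree_dist_le_diam[OF tree] x P by blast
    ultimately have "?d b x < real l / 4"
      using ab x commute[of a b] commute[of a x] by (auto simp: max_def split: if_splits)
    then show "x \<in> tree_ball V E b (real l / 4)" using x ab by (simp add: tree_ball_def)
  qed
  show ?thesis
    using sub[of u u'] sub[of u' u] P diam close commute[of u u'] by auto
qed

theorem lemma4p21:
  fixes l :: nat and V :: "'a set" and E :: "'a set set"
  assumes "0 < l" and "4 dvd l" and "is_long l V E"
  shows "\<exists>\<alpha>p \<alpha>m. \<alpha>p \<subseteq> points V E \<and> \<alpha>m \<subseteq> points V E \<and>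
    (\<forall>D. is_diameter V E D \<longrightarrow>
      (\<exists>up um. {up, um} = {D 0, D 1} \<and>
         \<alpha>p = points V E - tree_ball V E um (real l / 4) \<and>
         \<alpha>m = points V E - tree_ball V E up (real l / 4)))"
proof (cases "\<exists>D. is_diameter V E D")
  \<comment> \<open>Without a diameter the condition on the two subsets is vacuous.\<close>
  case False
  then show ?thesis by blast
next
  case True
  then obtain D where D: "is_diameter V E D" by blast
  have tree: "is_tree V E" using assms(3) by (simp add: is_long_def)
  interpret Metric_space "points V E" "tree_dist V E" by (rule Metric_space_tree[OF tree])
  let ?d = "tree_dist V E" and ?B = "\<lambda>u. tree_ball V E u (real l / 4)"
  note D' = diameter_endpoints[OF tree D]
  \<comment> \<open>The fixed diameter \<open>D\<close> serves as reference, with \<open>D 0\<close>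
    as positive and \<open>D 1\<close> as negative endpoint.\<close>
  have label: "\<exists>up um. {up, um} = {F 0, F 1} \<and> ?B um = ?B (D 1) \<and> ?B up = ?B (D 0)"
    if F: "is_diameter V E F" for F
  proof -
    note F' = diameter_endpoints[OF tree F]
    have "?d (D 0) (D 1) + ?d (F 0) (F 1)
      \<le> max (?d (D 0) (F 0) + ?d (D 1) (F 1)) (?d (D 0) (F 1) + ?d (D 1) (F 0))"
      by (rule four_pointD[OF four_point_tree_dist[OF tree]]) (use D' F' in auto)
    moreover have "?d a b \<le> tree_diam V E" if "a \<in> {D 0, D 1}" "b \<in> {F 0, F 1}" for a b
      using that D' F' by (intro tree_dist_le_diam[OF tree]) auto
    \<comment> \<open>One of the two sums is at least twice the diameter, while each summand is at
      most the diameter, so both summands attain it.\<close>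
    ultimately consider
        "?d (D 0) (F 0) = tree_diam V E" "?d (D 1) (F 1) = tree_diam V E"
      | "?d (D 0) (F 1) = tree_diam V E" "?d (D 1) (F 0) = tree_diam V E"
      using D'(3) F'(3) by (smt (verit) insertCI)
    then show ?thesis
    proof cases
      case 1
      \<comment> \<open>Here \<open>F 0\<close> and \<open>D 1\<close> both lie at maximal distance
        from \<open>D 0\<close> or \<open>F 1\<close>, so \<open>F\<close> runs opposite to
        \<open>D\<close> and its labels are swapped.\<close>
      then have "?B (F 0) = ?B (D 1)" "?B (F 1) = ?B (D 0)"
        using long_tree_ball_eq[OF assms(3), of "F 0" "F 1" "D 1"]
          long_tree_ball_eq[OF assms(3), of "F 1" "F 0" "D 0"] D' F' commute by metis+
      then show ?thesis by (intro exI[of _ "F 1"] exI[of _ "F 0"]) auto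
    next
      case 2
      then have "?B (F 0) = ?B (D 0)" "?B (F 1) = ?B (D 1)"
        using long_tree_ball_eq[OF assms(3), of "F 0" "F 1" "D 0"]
          long_tree_ball_eq[OF assms(3), of "F 1" "F 0" "D 1"] D' F' commute by metis+
      then show ?thesis by (intro exI[of _ "F 0"] exI[of _ "F 1"]) auto
    qed
  qed
  show ?thesis
  proof (rule exI[of _ "points V E - ?B (D 1)"], rule exI[of _ "points V E - ?B (D 0)"],
      intro conjI allI impI)
    fix F assume F: "is_diameter V E F"
    then obtain up um where "{up, um} = {F 0, F 1}" "?B um = ?B (D 1)" "?B up = ?B (D 0)"
      using label[OF F] by (elim exE conjE)
    then show "\<exists>up um. {up, um} = {F 0, F 1} \<and>
         points V E - ?B (D 1) = points V E - ?B um \<and>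
         points V E - ?B (D 0) = points V E - ?B up"
      by (intro exI[of _ up] exI[of _ um]) simp
  qed auto
qed

end
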